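(* Let $A$ be a subtracted image partition regular matrix and let $B$ be a weak Milliken–Taylor matrix. Then the diagonal sum $\begin{pmatrix} A & 0\\ 0 & B\end{pmatrix}$ is image partition regular.
   Context: $\omega=\{0,1,2,\dots\}$, $\mathbb{N}=\{1,2,\dots\}$. For $u,v\in\mathbb{N}\cup\{\omega\}$, a $u\times v$ matrix $A$ with rational entries (each row having only finitely many nonzero entries when $v=\omega$) is image partition regular if whenever $r\in\mathbb{N}$ and $\mathbb{N}=\bigcup_{i=1}^r C_i$, there exist $i\in\{1,\dots,r\}$ and $\vec{x}\in\mathbb{N}^v$ with $A\vec{x}\in C_i^u$. An $\omega\times\omega$ matrix $A$ with entries from $\mathbb{Q}$ is subtracted image partition regular if (1) no row of $A$ is $\vec{0}$; (2) for each $i\in\omega$, $\{j\in\omega:a_{ij}\neq0\}$ is finite; (3) writing $\vec{c_0},\vec{c_1},\dots$ for the columns of $A$, there exist $n\in\omega$ and $k\in\mathbb{N}$ such that the rows of $(\vec{c_n}\ \vec{c_{n+1}}\ \cdots\ \vec{c_{n+k-1}})$ are precisely the rows of a finite image partition regular matrix, and the remaining columns of $A$ form an image partition regular matrix. For a sequence $\vec{r}$ with entries in $\omega$, $d(\vec{r})$ is the sequence obtained by deleting all occurrences of $0$. An $\omega\times\omega$ matrix $B$ with entries from $\omega$ is a weak Milliken–Taylor matrix if each row has only finitely many nonzero entries and there is a finite sequence $\vec{a}\in\omega^m$, $m\in\mathbb{N}$, such that the rows of $B$ are exactly all row vectors $\vec{r}\in\omega^\omega$ with $d(\vec{r})=\vec{a}$.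 Here $0$ in the diagonal sum denotes zero matrices of the appropriate size. *)

theory Defs
  imports Complex_Main
begin

text \<open>
  A matrix is a function of a row index and a column index together with the sets of
  admissible row and column indices: \<open>{..<n}\<close> for a finite dimension \<open>n\<close>, \<open>UNIV :: nat set\<close> for
  the dimension \<open>\<omega>\<close>, and \<open>UNIV :: (nat + nat) set\<close> for the dimension \<open>\<omega> + \<omega>\<close> of a block matrix.
\<close>

definition mat_vec :: "'j set \<Rightarrow> ('i \<Rightarrow> 'j \<Rightarrow> rat) \<Rightarrow> ('j \<Rightarrow> nat) \<Rightarrow> 'i \<Rightarrow> rat" where
  "mat_vec J A x i = (\<Sum>j | j \<in> J \<and> A i j \<noteq> 0. A i j * of_nat (x j))"

definition image_partition_regular :: "'i set \<Rightarrow> 'j set \<Rightarrow> ('i \<Rightarrow> 'j \<Rightarrow> rat) \<Rightarrow> bool" where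
  "image_partition_regular I J A \<longleftrightarrow>
     (\<forall>i\<in>I. finite {j \<in> J. A i j \<noteq> 0}) \<and>
     (\<forall>r\<ge>1. \<forall>C :: nat \<Rightarrow> nat set. (\<Union>c\<in>{1..r}. C c) = {1..} \<longrightarrow>
        (\<exists>c\<in>{1..r}. \<exists>x. (\<forall>j\<in>J. x j \<ge> 1) \<and> (\<forall>i\<in>I. mat_vec J A x i \<in> of_nat ` C c)))"

text \<open>
  The column block is compared with \<open>F\<close> via sets of rows, each row of length \<open>k\<close> being written as a list.  The
  remaining columns keep their original indices, so they form a matrix with column index set
  \<open>UNIV - {n..<n + k}\<close>.
\<close>

definition subtracted_image_partition_regular :: "(nat \<Rightarrow> nat \<Rightarrow> rat) \<Rightarrow> bool" where
  "subtracted_image_partition_regular A \<longleftrightarrow>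
     (\<forall>i. \<exists>j. A i j \<noteq> 0) \<and>
     (\<forall>i. finite {j. A i j \<noteq> 0}) \<and>
     (\<exists>n k. k \<ge> 1 \<and>
        (\<exists>m::nat. m \<ge> 1 \<and> (\<exists>F. image_partition_regular {..<m} {..<k} F \<and>
           range (\<lambda>i. map (A i) [n..<n + k]) = (\<lambda>i. map (F i) [0..<k]) ` {..<m})) \<and>
        image_partition_regular UNIV (UNIV - {n..<n + k}) A)"

text \<open>Meaningful only for sequences with finitely many nonzero entries.\<close>

definition delete_zeros :: "(nat \<Rightarrow> nat) \<Rightarrow> nat list" where
  "delete_zeros r = map r (sorted_list_of_set {j. r j \<noteq> 0})"

definition weak_Milliken_Taylor :: "(nat \<Rightarrow> nat \<Rightarrow> nat) \<Rightarrow> bool" where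
  "weak_Milliken_Taylor B \<longleftrightarrow>
     (\<forall>i. finite {j. B i j \<noteq> 0}) \<and>
     (\<exists>a. length a \<ge> 1 \<and> range B = {r. finite {j. r j \<noteq> 0} \<and> delete_zeros r = a})"

fun diagonal_sum :: "('i \<Rightarrow> 'j \<Rightarrow> rat) \<Rightarrow> ('k \<Rightarrow> 'l \<Rightarrow> rat) \<Rightarrow> 'i + 'k \<Rightarrow> 'j + 'l \<Rightarrow> rat" where
  "diagonal_sum A B (Inl i) (Inl j) = A i j"
| "diagonal_sum A B (Inl i) (Inr j) = 0"
| "diagonal_sum A B (Inr i) (Inl j) = 0"
| "diagonal_sum A B (Inr i) (Inr j) = B i j"

end

theory Submission
  imports Defs "HOL-Library.Countable_Set"
begin

text \<open>
  If \<open>B\<close> is generated by \<open>a\<close> and \<open>s\<close> is the sum of the entries of \<open>a\<close>, then every row sum of \<open>B\<close>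
  is \<open>s\<close>, so \<open>B\<close> maps the constant vector \<open>t\<close> to the constant vector \<open>s * t\<close>. Hence, if the
  entries of \<open>A x\<close> are monochromatic for the colouring of \<open>n\<close> by the colour of \<open>s * n\<close>, then \<open>A\<close>
  applied to \<open>s * x\<close> and \<open>B\<close> applied to the constant vector whose value is an entry of \<open>A x\<close>
  have entries of one colour, and it remains to see that \<open>A\<close> is image partition regular.

  The images of \<open>A\<close> are sums of images of the finite block and of the remaining columns, so it
  suffices to find a monochromatic product \<open>X \<times> Y\<close> of two such images for every finite colouring
  of pairs. Shrinking the second factor step by step, one finds a colouring \<open>K\<close> of the first factor
  such that each finite set \<open>X\<close> admits an image \<open>Y\<close> for which \<open>{x} \<times> Y\<close> has colour \<open>K x\<close> for all
  \<open>x \<in> X\<close>; now let \<open>X\<close> be monochromatic for \<open>K\<close>. Finiteness of the block makes \<open>X\<close> finite.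
\<close>

subsection \<open>Partition regular families\<close>

definition partition_regular_on :: "'a set \<Rightarrow> 'a set set \<Rightarrow> bool" where
  "partition_regular_on S \<F> \<longleftrightarrow>
     (\<forall>\<C>. finite \<C> \<longrightarrow> \<Union>\<C> = S \<longrightarrow> (\<exists>C\<in>\<C>. \<exists>X\<in>\<F>. X \<subseteq> C))"

lemma partition_regular_onI:
  assumes "\<And>\<C>. finite \<C> \<Longrightarrow> \<Union>\<C> = S \<Longrightarrow> \<exists>C\<in>\<C>. \<exists>X\<in>\<F>. X \<subseteq> C"
  shows "partition_regular_on S \<F>"
  unfolding partition_regular_on_def using assms by blast

lemma partition_regular_onE:
  assumes "partition_regular_on S \<F>" and "finite \<C>" and "\<Union>\<C> = S"
  obtains C X where "C \<in> \<C>" "X \<in> \<F>" "X \<subseteq> C"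
  using assms unfolding partition_regular_on_def by blast

lemma partition_regular_on_member:
  assumes "partition_regular_on S \<F>"
  obtains X where "X \<in> \<F>" "X \<subseteq> S"
  by (rule partition_regular_onE[OF assms, of "{S}"]) auto

lemma partition_regular_on_nonempty:
  assumes "partition_regular_on S \<F>"
  shows "S \<noteq> {}"
  using partition_regular_onE[OF assms, of "{}"] by auto

lemma partition_regular_on_Union:
  assumes pr: "partition_regular_on (\<Union>\<C>) \<F>" and fin: "finite \<C>"
  shows "\<exists>C\<in>\<C>. partition_regular_on C \<F>"
proof (rule ccontr)
  assume "\<not> ?thesis"
  then have "\<forall>C\<in>\<C>. \<exists>\<D>. finite \<D> \<and> \<Union>\<D> = C \<and> (\<forall>D\<in>\<D>. \<forall>X\<in>\<F>. \<not> X \<subseteq> D)"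
    by (auto simp: partition_regular_on_def)
  from bchoice[OF this] obtain \<D>
    where \<D>: "\<forall>C\<in>\<C>. finite (\<D> C) \<and> \<Union>(\<D> C) = C \<and> (\<forall>D\<in>\<D> C. \<forall>X\<in>\<F>. \<not> X \<subseteq> D)" ..
  have "finite (\<Union>C\<in>\<C>. \<D> C)"
    using fin \<D> by simp
  moreover have "\<Union>(\<Union>C\<in>\<C>. \<D> C) = (\<Union>C\<in>\<C>. \<Union>(\<D> C))"
    by blast
  then have "\<Union>(\<Union>C\<in>\<C>. \<D> C) = \<Union>\<C>"
    using \<D> by simp
  ultimately obtain D X where "D \<in> (\<Union>C\<in>\<C>. \<D> C)" "X \<in> \<F>" "X \<subseteq> D"
    by (rule partition_regular_onE[OF pr])
  moreover have "\<forall>C\<in>\<C>. \<forall>D\<in>\<D> C. \<forall>X\<in>\<F>. \<not> X \<subseteq> D"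
    using \<D> by simp
  ultimately show False
    by blast
qed

lemma partition_regular_on_transfer:
  assumes pr: "partition_regular_on S \<F>" and g: "g ` S \<subseteq> T"
    and image: "\<And>X. X \<in> \<F> \<Longrightarrow> X \<subseteq> S \<Longrightarrow> \<exists>Y\<in>\<G>. Y \<subseteq> g ` X"
  shows "partition_regular_on T \<G>"
proof (rule partition_regular_onI)
  fix \<C> :: "'b set set"
  assume "finite \<C>" and "\<Union>\<C> = T"
  then have "finite ((\<lambda>C. S \<inter> g -` C) ` \<C>)" and "\<Union>((\<lambda>C. S \<inter> g -` C) ` \<C>) = S"
    using g by auto
  then obtain D X where "D \<in> (\<lambda>C. S \<inter> g -` C) ` \<C>" and X: "X \<in> \<F>" "X \<subseteq> D"
    by (rule partition_regular_onE[OF pr])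
  then obtain C where C: "C \<in> \<C>" "X \<subseteq> S" "g ` X \<subseteq> C"
    by auto
  with X(1) obtain Y where Y: "Y \<in> \<G>" "Y \<subseteq> g ` X"
    using image by blast
  from Y(2) C(3) have "Y \<subseteq> C"
    by (rule subset_trans)
  then show "\<exists>C\<in>\<C>. \<exists>Y\<in>\<G>. Y \<subseteq> C"
    using C(1) Y(1) by blast
qed

lemma partition_regular_on_decreasing_sequence:
  fixes C :: "nat \<Rightarrow> 'c \<Rightarrow> 'a set"
  assumes pr: "partition_regular_on S \<F>"
    and colours: "\<And>n. finite (K n)" and cover: "\<And>n. S \<subseteq> (\<Union>k\<in>K n. C n k)"
  shows "\<exists>T. \<forall>n. partition_regular_on (T n) \<F> \<and> T (Suc n) \<subseteq> T n \<and> (\<exists>k\<in>K n. T (Suc n) \<subseteq> C n k)"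
proof -
  have shrink: "\<exists>T'. (T' \<subseteq> S \<and> partition_regular_on T' \<F>) \<and> T' \<subseteq> T \<and> (\<exists>k\<in>K n. T' \<subseteq> C n k)"
    if T: "T \<subseteq> S \<and> partition_regular_on T \<F>" for T n
  proof -
    let ?part = "\<lambda>k. T \<inter> C n k"
    have "\<Union>(?part ` K n) = T"
      using T cover[of n] by auto
    then obtain k where "k \<in> K n" "partition_regular_on (?part k) \<F>"
      using partition_regular_on_Union[of "?part ` K n" \<F>] T colours[of n] by auto
    then show ?thesis
      using T by (intro exI[of _ "?part k"]) auto
  qed
  have "\<exists>T. \<forall>n. (T n \<subseteq> S \<and> partition_regular_on (T n) \<F>) \<and>
      T (Suc n) \<subseteq> T n \<and> (\<exists>k\<in>K n. T (Suc n) \<subseteq> C n k)"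
  proof (rule dependent_nat_choice)
    show "\<exists>T. T \<subseteq> S \<and> partition_regular_on T \<F>"
      using pr by blast
  qed (fact shrink)
  then show ?thesis
    by metis
qed

lemma partition_regular_on_choose_classes:
  fixes C :: "nat \<Rightarrow> 'c \<Rightarrow> 'a set"
  assumes "partition_regular_on S \<F>"
    and "\<And>n. finite (K n)" and "\<And>n. S \<subseteq> (\<Union>k\<in>K n. C n k)"
  shows "\<exists>k. (\<forall>n. k n \<in> K n) \<and> (\<forall>N. \<exists>X\<in>\<F>. \<forall>n<N. X \<subseteq> C n (k n))"
proof -
  obtain T where T: "\<And>n. partition_regular_on (T n) \<F>"
    and decreasing: "\<And>n. T (Suc n) \<subseteq> T n" and "\<And>n. \<exists>k\<in>K n. T (Suc n) \<subseteq> C n k"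
    using partition_regular_on_decreasing_sequence[where C = C, OF assms] by metis
  then obtain k where k: "\<And>n. k n \<in> K n" "\<And>n. T (Suc n) \<subseteq> C n (k n)"
    by metis
  have "\<exists>X\<in>\<F>. \<forall>n<N. X \<subseteq> C n (k n)" for N
  proof -
    obtain X where X: "X \<in> \<F>" "X \<subseteq> T N"
      using partition_regular_on_member[OF T] .
    have "X \<subseteq> C n (k n)" if "n < N" for n
    proof -
      have "T N \<subseteq> T (Suc n)"
        using that by (intro lift_Suc_antimono_le[of T, OF decreasing]) (simp add: Suc_le_eq)
      then show ?thesis
        using X(2) k(2)[of n] by simp
    qed
    then show ?thesis
      using X(1) by blast
  qed
  then show ?thesis
    using k(1) by blast
qed

theorem partition_regular_on_Times:
  assumes \<F>: "partition_regular_on S \<F>" "countable S" "\<And>X. X \<in> \<F> \<Longrightarrow> finite X"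
    and \<G>: "partition_regular_on T \<G>"
  shows "partition_regular_on (S \<times> T) {X \<times> Y | X Y. X \<in> \<F> \<and> Y \<in> \<G>}"
proof (rule partition_regular_onI)
  fix \<C> :: "('a \<times> 'b) set set"
  assume \<C>: "finite \<C>" "\<Union>\<C> = S \<times> T"
  let ?s = "from_nat_into S" and ?n = "to_nat_on S"
  have s_n: "?s (?n x) = x" if "x \<in> S" for x
    using \<F>(2) that by simp
  have "T \<subseteq> (\<Union>C\<in>\<C>. Pair (?s n) -` C)" for n
    using from_nat_into[OF partition_regular_on_nonempty[OF \<F>(1)], of n] \<C>(2) by auto
  from partition_regular_on_choose_classes
      [where C = "\<lambda>n C. Pair (?s n) -` C", OF \<G> \<C>(1) this] obtain K
    where K: "\<And>n. K n \<in> \<C>" and common: "\<And>N. \<exists>Y\<in>\<G>. \<forall>n<N. Y \<subseteq> Pair (?s n) -` K n"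
    by auto
  let ?class = "\<lambda>C. {x \<in> S. K (?n x) = C}"
  have "finite (?class ` \<C>)" and "\<Union>(?class ` \<C>) = S"
    using \<C>(1) K by auto
  then obtain E X where "E \<in> ?class ` \<C>" and X: "X \<in> \<F>" "X \<subseteq> E"
    by (rule partition_regular_onE[OF \<F>(1)])
  then obtain C where C: "C \<in> \<C>" "X \<subseteq> ?class C"
    by auto
  obtain N where N: "\<And>x. x \<in> X \<Longrightarrow> ?n x < N"
    using finite_nat_set_iff_bounded[of "?n ` X"] \<F>(3)[OF X(1)] by auto
  obtain Y where Y: "Y \<in> \<G>" "\<And>n. n < N \<Longrightarrow> Y \<subseteq> Pair (?s n) -` K n"
    using common by blast
  have "X \<times> Y \<subseteq> C"
  proof clarify
    fix x y assume "x \<in> X" "y \<in> Y"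
    then have "y \<in> Pair (?s (?n x)) -` K (?n x)" "x \<in> S" "K (?n x) = C"
      using Y(2) N C(2) by auto
    then show "(x, y) \<in> C"
      by (simp add: s_n)
  qed
  then show "\<exists>C\<in>\<C>. \<exists>Z\<in>{X \<times> Y | X Y. X \<in> \<F> \<and> Y \<in> \<G>}. Z \<subseteq> C"
    using C(1) X(1) Y(1) by blast
qed

lemma partition_regular_on_iff_indexed:
  assumes "S \<noteq> {}"
  shows "partition_regular_on S \<F> \<longleftrightarrow>
    (\<forall>r\<ge>1. \<forall>C :: nat \<Rightarrow> 'a set. (\<Union>c\<in>{1..r}. C c) = S \<longrightarrow> (\<exists>c\<in>{1..r}. \<exists>X\<in>\<F>. X \<subseteq> C c))"
    (is "_ \<longleftrightarrow> ?indexed")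
proof
  assume pr: "partition_regular_on S \<F>"
  show ?indexed
  proof (intro allI impI)
    fix r and C :: "nat \<Rightarrow> 'a set"
    assume "(\<Union>c\<in>{1..r}. C c) = S"
    then obtain D X where "D \<in> C ` {1..r}" "X \<in> \<F>" "X \<subseteq> D"
      using partition_regular_onE[OF pr] by (metis finite_atLeastAtMost finite_imageI)
    then show "\<exists>c\<in>{1..r}. \<exists>X\<in>\<F>. X \<subseteq> C c"
      by blast
  qed
next
  assume indexed: ?indexed
  show "partition_regular_on S \<F>"
  proof (rule partition_regular_onI)
    fix \<C> :: "'a set set"
    assume \<C>: "finite \<C>" "\<Union>\<C> = S"
    obtain C where "bij_betw C {1..card \<C>} \<C>"
      using ex_bij_betw_nat_finite_1[OF \<C>(1)] by blast
    then have C: "C ` {1..card \<C>} = \<C>"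
      by (rule bij_betw_imp_surj_on)
    have "card \<C> \<ge> 1"
      using \<C> assms by (cases "\<C> = {}") (auto simp: Suc_le_eq card_gt_0_iff)
    moreover have "(\<Union>c\<in>{1..card \<C>}. C c) = S"
      using C \<C>(2) by simp
    ultimately have "\<exists>c\<in>{1..card \<C>}. \<exists>X\<in>\<F>. X \<subseteq> C c"
      by (rule indexed[rule_format])
    then show "\<exists>C\<in>\<C>. \<exists>X\<in>\<F>. X \<subseteq> C"
      using C by blast
  qed
qed

subsection \<open>Matrix-vector products\<close>

lemma mat_vec_cong:
  assumes "\<And>j. j \<in> J \<Longrightarrow> x j = y j"
  shows "mat_vec J A x i = mat_vec J A y i"
  using assms by (auto simp: mat_vec_def intro: sum.cong)

lemma mat_vec_scale: "mat_vec J A (\<lambda>j. s * x j) i = of_nat s * mat_vec J A x i"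
  by (simp add: mat_vec_def sum_distrib_left algebra_simps)

lemma mat_vec_const: "mat_vec J A (\<lambda>_. t) i = of_nat t * mat_vec J A (\<lambda>_. 1) i"
  using mat_vec_scale[of J A t "\<lambda>_. 1" i] by simp

lemma mat_vec_Un_disjoint:
  assumes "J \<inter> K = {}" and "finite {j \<in> J. A i j \<noteq> 0}" and "finite {j \<in> K. A i j \<noteq> 0}"
  shows "mat_vec (J \<union> K) A (\<lambda>j. if j \<in> J then x j else y j) i =
    mat_vec J A x i + mat_vec K A y i" (is "mat_vec _ A ?z i = _")
proof -
  have "{j \<in> J \<union> K. A i j \<noteq> 0} = {j \<in> J. A i j \<noteq> 0} \<union> {j \<in> K. A i j \<noteq> 0}"
    by auto
  moreover have "{j \<in> J. A i j \<noteq> 0} \<inter> {j \<in> K. A i j \<noteq> 0} = {}"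
    using assms(1) by auto
  ultimately have "mat_vec (J \<union> K) A ?z i = mat_vec J A ?z i + mat_vec K A ?z i"
    unfolding mat_vec_def using assms(2,3) by (simp only: sum.union_disjoint)
  also have "mat_vec J A ?z i = mat_vec J A x i"
    by (rule mat_vec_cong) simp
  also have "mat_vec K A ?z i = mat_vec K A y i"
    using assms(1) by (intro mat_vec_cong) auto
  finally show ?thesis .
qed

lemma row_support_reindex:
  assumes "g ` J \<subseteq> K" and "\<And>j. j \<in> J \<Longrightarrow> A i (g j) = F i' j"
    and "\<And>l. l \<in> K - g ` J \<Longrightarrow> A i l = 0"
  shows "{l \<in> K. A i l \<noteq> 0} = g ` {j \<in> J. F i' j \<noteq> 0}"
  using assms by force

lemma mat_vec_reindex:
  assumes g: "inj_on g J" "g ` J \<subseteq> K" and F: "\<And>j. j \<in> J \<Longrightarrow> A i (g j) = F i' j"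
    and zero: "\<And>l. l \<in> K - g ` J \<Longrightarrow> A i l = 0"
  shows "mat_vec K A x i = mat_vec J F (x \<circ> g) i'"
proof -
  have "inj_on g {j \<in> J. F i' j \<noteq> 0}"
    using g(1) by (rule inj_on_subset) auto
  then show ?thesis
    using row_support_reindex[of g J K A i F i', OF g(2) F zero]
    by (simp add: mat_vec_def sum.reindex F)
qed

subsection \<open>Image partition regularity\<close>

definition image_sets :: "'i set \<Rightarrow> 'j set \<Rightarrow> ('i \<Rightarrow> 'j \<Rightarrow> rat) \<Rightarrow> nat set set" where
  "image_sets I J A = {W. \<exists>x. (\<forall>j\<in>J. x j \<ge> 1) \<and> of_nat ` W = mat_vec J A x ` I}"

lemma image_sets_subset_iff:
  "(\<exists>W\<in>image_sets I J A. W \<subseteq> C) \<longleftrightarrow>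
     (\<exists>x. (\<forall>j\<in>J. x j \<ge> 1) \<and> mat_vec J A x ` I \<subseteq> of_nat ` C)"
proof
  assume "\<exists>x. (\<forall>j\<in>J. x j \<ge> 1) \<and> mat_vec J A x ` I \<subseteq> of_nat ` C"
  then obtain x where x: "\<forall>j\<in>J. x j \<ge> 1" and "mat_vec J A x ` I \<subseteq> of_nat ` C"
    by blast
  then obtain W where W: "W \<subseteq> C" "mat_vec J A x ` I = of_nat ` W"
    by (auto elim: subset_imageE)
  have "W \<in> image_sets I J A"
    unfolding image_sets_def using x W(2)[symmetric] by (intro CollectI exI conjI)
  then show "\<exists>W\<in>image_sets I J A. W \<subseteq> C"
    using W(1) by blast
next
  assume "\<exists>W\<in>image_sets I J A. W \<subseteq> C"
  then obtain W x where "W \<subseteq> C" and x: "\<forall>j\<in>J. x j \<ge> 1" "of_nat ` W = mat_vec J A x ` I"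
    unfolding image_sets_def by blast
  then have "mat_vec J A x ` I \<subseteq> of_nat ` C"
    by (metis image_mono)
  then show "\<exists>x. (\<forall>j\<in>J. x j \<ge> 1) \<and> mat_vec J A x ` I \<subseteq> of_nat ` C"
    using x(1) by blast
qed

lemma image_partition_regular_iff:
  "image_partition_regular I J A \<longleftrightarrow>
     (\<forall>i\<in>I. finite {j \<in> J. A i j \<noteq> 0}) \<and> partition_regular_on {1..} (image_sets I J A)"
proof -
  have "{1 :: nat..} \<noteq> {}"
    by simp
  from partition_regular_on_iff_indexed[OF this] show ?thesis
    by (simp only: image_partition_regular_def image_sets_subset_iff image_subset_iff)
qed

lemma image_partition_regular_transfer:
  assumes pr: "partition_regular_on S \<F>" and g: "g ` S \<subseteq> {1..}"
    and rows: "\<And>i. i \<in> I \<Longrightarrow> finite {j \<in> J. A i j \<noteq> 0}"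
    and image: "\<And>X. X \<in> \<F> \<Longrightarrow> X \<subseteq> S \<Longrightarrow>
      \<exists>x. (\<forall>j\<in>J. x j \<ge> 1) \<and> mat_vec J A x ` I \<subseteq> of_nat ` g ` X"
  shows "image_partition_regular I J A"
  using rows partition_regular_on_transfer[OF pr g] image
  by (simp add: image_partition_regular_iff image_sets_subset_iff)

lemma mat_vec_image_reindex_subset:
  assumes g: "inj_on g J" and rows: "\<And>i. i \<in> I \<Longrightarrow> \<exists>i'\<in>I'. \<forall>j\<in>J. A i (g j) = F i' j"
  shows "mat_vec (g ` J) A x ` I \<subseteq> mat_vec J F (x \<circ> g) ` I'"
proof (rule image_subsetI)
  fix i assume "i \<in> I"
  then obtain i' where "i' \<in> I'" "\<forall>j\<in>J. A i (g j) = F i' j"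
    using rows by blast
  then show "mat_vec (g ` J) A x i \<in> mat_vec J F (x \<circ> g) ` I'"
    using mat_vec_reindex[of g J "g ` J" A i F i' x] g by auto
qed

lemma image_partition_regular_reindex:
  assumes F: "image_partition_regular I' J F" and g: "inj_on g J"
    and rows: "\<And>i. i \<in> I \<Longrightarrow> \<exists>i'\<in>I'. \<forall>j\<in>J. A i (g j) = F i' j"
  shows "image_partition_regular I (g ` J) A"
proof (rule image_partition_regular_transfer)
  show "partition_regular_on {1..} (image_sets I' J F)"
    using F by (simp add: image_partition_regular_iff)
  show "id ` {1..} \<subseteq> {1..}"
    by simp
  fix X assume "X \<in> image_sets I' J F"
  then obtain x where x: "\<forall>j\<in>J. x j \<ge> 1" and X: "of_nat ` X = mat_vec J F x ` I'"
    by (auto simp: image_sets_def)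
  let ?y = "x \<circ> the_inv_into J g"
  have "mat_vec J F (?y \<circ> g) i' = mat_vec J F x i'" for i'
    using g by (intro mat_vec_cong) (simp add: the_inv_into_f_f)
  then have "mat_vec (g ` J) A ?y ` I \<subseteq> of_nat ` id ` X"
    using mat_vec_image_reindex_subset[OF g rows, where x = ?y] X by simp
  moreover have "\<forall>l\<in>g ` J. ?y l \<ge> 1"
    using x g by (simp add: the_inv_into_f_f)
  ultimately show "\<exists>y. (\<forall>l\<in>g ` J. y l \<ge> 1) \<and> mat_vec (g ` J) A y ` I \<subseteq> of_nat ` id ` X"
    by blast
next
  fix i assume "i \<in> I"
  then obtain i' where "i' \<in> I'" "\<forall>j\<in>J. A i (g j) = F i' j"
    using rows by blast
  then show "finite {l \<in> g ` J. A i l \<noteq> 0}"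
    using F row_support_reindex[of g J "g ` J" A i F i'] by (simp add: image_partition_regular_def)
qed

theorem image_partition_regular_Un_columns:
  assumes J: "image_partition_regular I J A" and K: "image_partition_regular I K A"
    and disjoint: "J \<inter> K = {}" and finite_image: "\<And>x. finite (mat_vec J A x ` I)"
  shows "image_partition_regular I (J \<union> K) A"
proof -
  let ?\<F> = "{X \<times> Y | X Y. X \<in> image_sets I J A \<and> Y \<in> image_sets I K A}"
  have "finite X" if "X \<in> image_sets I J A" for X
    using that finite_image finite_imageD[of "of_nat :: nat \<Rightarrow> rat" X]
    by (auto simp: image_sets_def)
  then have pr: "partition_regular_on ({1..} \<times> {1..}) ?\<F>"
    using J K by (intro partition_regular_on_Times) (auto simp: image_partition_regular_iff)
  have rows: "finite {j \<in> J. A i j \<noteq> 0}" "finite {j \<in> K. A i j \<noteq> 0}" if "i \<in> I" for i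
    using that J K by (auto simp: image_partition_regular_def)
  show ?thesis
  proof (rule image_partition_regular_transfer[OF pr])
    show "(\<lambda>(m, n). m + n) ` ({1..} \<times> {1..}) \<subseteq> {1::nat..}"
      by auto
    show "finite {j \<in> J \<union> K. A i j \<noteq> 0}" if "i \<in> I" for i
      using rows[OF that] by (simp add: conj_disj_distribR Collect_disj_eq)
    fix Z assume "Z \<in> ?\<F>"
    then obtain X Y x y where Z: "Z = X \<times> Y"
      and x: "\<forall>j\<in>J. x j \<ge> 1" "of_nat ` X = mat_vec J A x ` I"
      and y: "\<forall>j\<in>K. y j \<ge> 1" "of_nat ` Y = mat_vec K A y ` I"
      by (auto simp: image_sets_def)
    let ?z = "\<lambda>j. if j \<in> J then x j else y j"
    have "mat_vec (J \<union> K) A ?z i \<in> of_nat ` (\<lambda>(m, n). m + n) ` Z" if i: "i \<in> I" for i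
    proof -
      have "mat_vec J A x i \<in> of_nat ` X" "mat_vec K A y i \<in> of_nat ` Y"
        using i x(2) y(2) by auto
      then show ?thesis
        unfolding mat_vec_Un_disjoint[of J K A i, OF disjoint rows[OF i]] Z by force
    qed
    moreover have "\<forall>j\<in>J \<union> K. ?z j \<ge> 1"
      using x(1) y(1) by auto
    ultimately show "\<exists>z. (\<forall>j\<in>J \<union> K. z j \<ge> 1) \<and>
        mat_vec (J \<union> K) A z ` I \<subseteq> of_nat ` (\<lambda>(m, n). m + n) ` Z"
      by (intro exI[of _ ?z]) blast
  qed
qed

theorem subtracted_imp_image_partition_regular:
  assumes "subtracted_image_partition_regular A"
  shows "image_partition_regular UNIV UNIV A"
proof -
  obtain n k m F where F: "image_partition_regular {..<m} {..<k} F"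
    and rows: "range (\<lambda>i. map (A i) [n..<n + k]) = (\<lambda>i. map (F i) [0..<k]) ` {..<m::nat}"
    and remaining: "image_partition_regular UNIV (UNIV - {n..<n + k}) A"
    using assms unfolding subtracted_image_partition_regular_def by blast
  have block_row: "\<exists>i'\<in>{..<m}. \<forall>j\<in>{..<k}. A i (n + j) = F i' j" for i
  proof -
    have "map (A i) [n..<n + k] \<in> (\<lambda>i. map (F i) [0..<k]) ` {..<m}"
      using rows by blast
    then show ?thesis
      by (auto simp: list_eq_iff_nth_eq)
  qed
  have columns: "{n..<n + k} = (+) n ` {..<k}"
    by (simp add: lessThan_atLeast0 add.commute)
  have block: "image_partition_regular UNIV {n..<n + k} A"
    unfolding columns using F by (rule image_partition_regular_reindex) (simp_all add: block_row)
  have finite_block: "finite (range (mat_vec {n..<n + k} A x))" for x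
  proof (rule finite_subset)
    show "range (mat_vec {n..<n + k} A x) \<subseteq> mat_vec {..<k} F (x \<circ> (+) n) ` {..<m}"
      unfolding columns by (rule mat_vec_image_reindex_subset) (simp_all add: block_row)
  qed simp
  show ?thesis
    using image_partition_regular_Un_columns[OF block remaining _ finite_block] by simp
qed

subsection \<open>Diagonal sums with constant row sums\<close>

lemma row_support_diagonal_sum_Inl:
  "{j \<in> J <+> L. diagonal_sum A B (Inl i) j \<noteq> 0} = Inl ` {j \<in> J. A i j \<noteq> 0}"
  by (rule row_support_reindex) auto

lemma row_support_diagonal_sum_Inr:
  "{j \<in> J <+> L. diagonal_sum A B (Inr i) j \<noteq> 0} = Inr ` {j \<in> L. B i j \<noteq> 0}"
  by (rule row_support_reindex) auto

lemma mat_vec_diagonal_sum_Inl: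
  "mat_vec (J <+> L) (diagonal_sum A B) z (Inl i) = mat_vec J A (z \<circ> Inl) i"
  by (rule mat_vec_reindex) auto

lemma mat_vec_diagonal_sum_Inr:
  "mat_vec (J <+> L) (diagonal_sum A B) z (Inr i) = mat_vec L B (z \<circ> Inr) i"
  by (rule mat_vec_reindex) auto

theorem image_partition_regular_diagonal_sum:
  fixes A :: "'i \<Rightarrow> 'j \<Rightarrow> rat" and B :: "'k \<Rightarrow> 'l \<Rightarrow> rat"
  assumes A: "image_partition_regular I J A" and I: "I \<noteq> {}"
    and B: "\<And>i. i \<in> K \<Longrightarrow> finite {j \<in> L. B i j \<noteq> 0}"
    and s: "s \<ge> 1" and row_sum: "\<And>i. i \<in> K \<Longrightarrow> mat_vec L B (\<lambda>_. 1) i = of_nat s"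
  shows "image_partition_regular (I <+> K) (J <+> L) (diagonal_sum A B)"
proof (rule image_partition_regular_transfer)
  show "partition_regular_on {1..} (image_sets I J A)"
    using A by (simp add: image_partition_regular_iff)
  show "(*) s ` {1..} \<subseteq> {1..}"
    using s by (auto simp: Suc_le_eq)
  show "finite {j \<in> J <+> L. diagonal_sum A B i j \<noteq> 0}" if "i \<in> I <+> K" for i
    using that A B
    by (auto simp: image_partition_regular_def row_support_diagonal_sum_Inl
        row_support_diagonal_sum_Inr)
  fix X assume "X \<in> image_sets I J A" and pos: "X \<subseteq> {1..}"
  then obtain x where x: "\<forall>j\<in>J. x j \<ge> 1" and X: "of_nat ` X = mat_vec J A x ` I"
    by (auto simp: image_sets_def)
  then obtain t where t: "t \<in> X"
    using I by blast
  define z :: "'j + 'l \<Rightarrow> nat" where "z = case_sum (\<lambda>j. s * x j) (\<lambda>_. t)"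
  have z: "z \<circ> Inl = (\<lambda>j. s * x j)" "z \<circ> Inr = (\<lambda>_. t)"
    by (auto simp: z_def)
  have "mat_vec (J <+> L) (diagonal_sum A B) z i \<in> of_nat ` (*) s ` X" if "i \<in> I <+> K" for i
    using that
  proof (elim PlusE)
    fix i' assume i: "i' \<in> I" "i = Inl i'"
    then have "mat_vec J A x i' \<in> of_nat ` X"
      using X by blast
    then show ?thesis
      unfolding i(2) mat_vec_diagonal_sum_Inl z mat_vec_scale by force
  next
    fix i' assume i: "i' \<in> K" "i = Inr i'"
    then have "mat_vec (J <+> L) (diagonal_sum A B) z i = of_nat (s * t)"
      by (simp only: mat_vec_diagonal_sum_Inr z mat_vec_const[of L B t] row_sum of_nat_mult
          mult.commute)
    then show ?thesis
      using t by blast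
  qed
  moreover have "\<forall>j\<in>J <+> L. z j \<ge> 1"
    using x s t pos by (auto simp: z_def Suc_le_eq)
  ultimately show "\<exists>z. (\<forall>j\<in>J <+> L. z j \<ge> 1) \<and>
      mat_vec (J <+> L) (diagonal_sum A B) z ` (I <+> K) \<subseteq> of_nat ` (*) s ` X"
    by blast
qed

lemma sum_list_delete_zeros:
  assumes "finite {j. r j \<noteq> 0}"
  shows "sum_list (delete_zeros r) = (\<Sum>j | r j \<noteq> 0. r j)"
  using assms by (simp add: delete_zeros_def sum_list_distinct_conv_sum_set)

lemma weak_Milliken_Taylor_row_sum:
  assumes "weak_Milliken_Taylor B"
  obtains s where "s \<ge> 1" "\<And>i. mat_vec UNIV (\<lambda>i j. of_nat (B i j)) (\<lambda>_. 1) i = of_nat s"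
proof -
  obtain a where "length a \<ge> 1" and fin: "\<And>i. finite {j. B i j \<noteq> 0}"
    and rows: "range B = {r. finite {j. r j \<noteq> 0} \<and> delete_zeros r = a}"
    using assms unfolding weak_Milliken_Taylor_def by blast
  have a: "delete_zeros (B i) = a" for i
    using rows by blast
  show thesis
  proof
    have "0 \<notin> set a"
      using fin[of 0] by (auto simp: a[of 0, symmetric] delete_zeros_def)
    then show "sum_list a \<ge> 1"
      using \<open>length a \<ge> 1\<close> by (cases a) auto
    show "mat_vec UNIV (\<lambda>i j. of_nat (B i j)) (\<lambda>_. 1) i = of_nat (sum_list a)" for i
      using sum_list_delete_zeros[OF fin[of i]] by (simp add: mat_vec_def a)
  qed
qed

theorem theorem3p4:
  fixes A :: "nat \<Rightarrow> nat \<Rightarrow> rat" and B :: "nat \<Rightarrow> nat \<Rightarrow> nat"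
  assumes "subtracted_image_partition_regular A"
    and "weak_Milliken_Taylor B"
  shows "image_partition_regular UNIV UNIV (diagonal_sum A (\<lambda>i j. of_nat (B i j)))"
proof -
  have A: "image_partition_regular UNIV UNIV A"
    using assms(1) by (rule subtracted_imp_image_partition_regular)
  have B: "finite {j \<in> UNIV. (of_nat (B i j) :: rat) \<noteq> 0}" for i
    using assms(2) by (simp add: weak_Milliken_Taylor_def)
  obtain s where "s \<ge> 1" "\<And>i. mat_vec UNIV (\<lambda>i j. of_nat (B i j)) (\<lambda>_. 1) i = of_nat s"
    using weak_Milliken_Taylor_row_sum[OF assms(2)] by blast
  with A B show ?thesis
    using image_partition_regular_diagonal_sum[of UNIV UNIV A UNIV UNIV "\<lambda>i j. of_nat (B i j)" s]
    by (simp only: UNIV_Plus_UNIV) blast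
qed

end
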